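(* Let $q\geq 2$ be an integer and $p=2q$. Let $X$ be a symmetric real random variable, not almost surely zero, with finite moments of all orders, let $X_1,X_2,\ldots,X_n$ be iid copies of $X$, and let $r_k=\frac{k!\,\mathbb{E}[X^{2k}]}{(2k)!}$ for $k\geq 0$. Let $a=(a_1,\ldots,a_n)\in\mathbb{R}^n$ satisfy $\sum_{k=1}^n a_k^2=1$ and put $S=\sum_{k=1}^n a_kX_k$. Then the following hold, with $\Delta_q(a)$ as defined in the context. (1) If $(r_k)_{k\ge 0}$ is log-concave, then $r_1^2-r_2\geq 0$ and $$\|S\|_p^p\leq \gamma_p^p\|S\|_2^p-2^q\gamma_p^p\,r_1^{q-2}(r_1^2-r_2)\,\Delta_q(a).$$ (2) If $(r_k)_{k\ge 0}$ is log-convex, then $r_2-r_1^2\geq 0$ and $$\|S\|_p^p\geq \gamma_p^p\|S\|_2^p+2^q\gamma_p^p\,r_1^{q-2}(r_2-r_1^2)\,\Delta_q(a).$$ Moreover, the constants are asymptotically sharp near the Gaussian extremizer, in the following sense: for $a=(\frac{1}{\sqrt n},\ldots,\frac{1}{\sqrt n})\in\mathbb{R}^n$, the left-hand side and the right-hand side of the inequality in (1) (respectively (2)) differ by $O(n^{-2})$ as $n\to\infty$ (with $X$ and $q$ fixed).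
   Context: $\|Y\|_p=(\mathbb{E}|Y|^p)^{1/p}$ denotes the $L_p$ norm of a random variable $Y$, and $\gamma_p$ denotes the $L_p$ norm of a standard Gaussian random variable. A random variable $X$ is symmetric if $X$ and $-X$ have the same distribution. A sequence of positive numbers $(r_k)_{k\geq 0}$ is log-concave if $r_k^2\geq r_{k-1}r_{k+1}$ for all $k\geq 1$, and log-convex if $r_k^2\leq r_{k-1}r_{k+1}$ for all $k\geq 1$. For an integer $q\geq 2$ and $a\in\mathbb{R}^n$ with $\sum_{k=1}^n a_k^2=1$, define $$\Delta_q(a)=\begin{cases}1 & \text{if } n<q,\\ 1-q!\binom{n}{q}\Big(\frac{1-\sum_{k=1}^n a_k^4}{n(n-1)}\Big)^{q/2} & \text{if } n\geq q.\end{cases}$$ *)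

theory Defs
  imports "HOL-Probability.Probability" "HOL-Library.Landau_Symbols"
begin

definition Lp_norm :: "'a measure \<Rightarrow> real \<Rightarrow> ('a \<Rightarrow> real) \<Rightarrow> real" where
  "Lp_norm M p Y = (\<integral>\<omega>. \<bar>Y \<omega>\<bar> powr p \<partial>M) powr (1 / p)"

definition gauss_norm :: "real \<Rightarrow> real" where
  "gauss_norm p = Lp_norm (density lborel std_normal_density) p (\<lambda>x. x)"

definition symmetric_rv :: "'a measure \<Rightarrow> ('a \<Rightarrow> real) \<Rightarrow> bool" where
  "symmetric_rv M X \<longleftrightarrow> distr M borel X = distr M borel (\<lambda>\<omega>. - X \<omega>)"

(* The copies Y i may live on a probability space N other than the one carrying X.
   indep_vars includes measurability of each Y i. *)
definition iid_copies ::
    "'b measure \<Rightarrow> ('i \<Rightarrow> 'b \<Rightarrow> real) \<Rightarrow> 'i set \<Rightarrow> 'a measure \<Rightarrow> ('a \<Rightarrow> real) \<Rightarrow> bool" where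
  "iid_copies N Y I M X \<longleftrightarrow>
     prob_space N \<and> prob_space.indep_vars N (\<lambda>_. borel) Y I \<and>
     (\<forall>i\<in>I. distr N borel (Y i) = distr M borel X)"

definition log_concave :: "(nat \<Rightarrow> real) \<Rightarrow> bool" where
  "log_concave r \<longleftrightarrow> (\<forall>k. 0 < r k) \<and> (\<forall>k\<ge>1. (r k)\<^sup>2 \<ge> r (k - 1) * r (k + 1))"

definition log_convex :: "(nat \<Rightarrow> real) \<Rightarrow> bool" where
  "log_convex r \<longleftrightarrow> (\<forall>k. 0 < r k) \<and> (\<forall>k\<ge>1. (r k)\<^sup>2 \<le> r (k - 1) * r (k + 1))"

(* A vector in R^n is a function on nat of which only the entries 1, ..., n matter. *)
definition Delta :: "nat \<Rightarrow> nat \<Rightarrow> (nat \<Rightarrow> real) \<Rightarrow> real" where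
  "Delta q n a =
     (if n < q then 1
      else 1 - fact q * real (n choose q) *
             ((1 - (\<Sum>k=1..n. a k ^ 4)) / (real n * (real n - 1))) powr (real q / 2))"

end

theory Submission
  imports Defs "HOL-Computational_Algebra.Formal_Laurent_Series"
begin

text \<open>
  Put \<open>x\<^sub>k = (a k)\<^sup>2\<close>, which are probabilities, and let \<open>\<gamma>\<close> be the \<open>p\<close>-th absolute moment of a
  standard Gaussian, \<open>\<gamma> = (2 q)! / (2 ^ q q!)\<close>. Expanding \<open>S ^ (2 q)\<close> and dropping the odd moments,
  which vanish by symmetry, gives
  \<open>E S ^ (2 q) = 2 ^ q \<gamma> \<Sum> q! / (k\<^sub>1! \<cdots> k\<^sub>n!) \<Prod> x\<^sub>i ^ k\<^sub>i r (k\<^sub>i)\<close>, the sum being over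
  \<open>k\<^sub>1 + \<cdots> + k\<^sub>n = q\<close> (lemma \<open>iid_copies_moment\<close>). The sum on the right is an expectation: throw
  \<open>q\<close> independent balls into \<open>n\<close> urns with probabilities \<open>x\<^sub>i\<close>, let \<open>k\<^sub>i\<close> be the occupancies, and
  average \<open>\<Prod> r (k\<^sub>i)\<close>. It is called an occupancy sum here.

  If no two balls share an urn, the product is \<open>r 1 ^ q\<close>. Otherwise some \<open>k\<^sub>i \<ge> 2\<close>, and since
  \<open>r 0 = 1\<close>, log-concavity gives \<open>r k \<le> r 1 ^ k\<close> for all \<open>k\<close> and \<open>r k \<le> r 2 * r 1 ^ (k - 2)\<close> for
  \<open>k \<ge> 2\<close>, so the product is at most \<open>r 1 ^ (q - 2) * r 2\<close>. Thus the sum is at most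
  \<open>r 1 ^ q - r 1 ^ (q - 2) * ((r 1)\<^sup>2 - r 2) * P\<close>, where \<open>P\<close> is the probability of a collision
  (lemma \<open>occ_log_concave_le\<close>); for log-convex \<open>r\<close> all inequalities turn around. As
  \<open>1 - P\<close> is \<open>q!\<close> times the elementary symmetric polynomial of degree \<open>q\<close> in the \<open>x\<^sub>i\<close>, Maclaurin's
  inequality between the degrees \<open>2\<close> and \<open>q\<close> says that \<open>P \<ge> Delta q n a\<close> (lemma \<open>Delta_le\<close>), and the
  first summand \<open>2 ^ q \<gamma> r 1 ^ q\<close> is the Gaussian term, because \<open>E S\<^sup>2 = 2 r 1\<close>.

  For equal \<open>x\<^sub>i\<close> Maclaurin's inequality is an equality, and the only other loss is in the
  configurations with a collision that are not just a single pair sharing an urn. Their probability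
  is \<open>O(1 / n\<^sup>2)\<close>, which is the asymptotic sharpness (lemma \<open>occ_uniform_defect\<close>).
\<close>

unbundle fps_syntax and no vec_syntax

section \<open>Occupancy sums\<close>

definition egf :: "(nat \<Rightarrow> real) \<Rightarrow> real fps" where
  "egf r = Abs_fps (\<lambda>k. r k / fact k)"

text \<open>
  Up to the normalisation by the factorial this is a coefficient of a product of exponential
  generating functions, so it equals
  \<open>\<Sum> m! / (k\<^sub>1! \<cdots> k\<^sub>n!) \<Prod> x\<^sub>i ^ k\<^sub>i r (k\<^sub>i)\<close>, summed over \<open>k\<^sub>1 + \<cdots> + k\<^sub>n = m\<close>. If the \<open>x\<^sub>i\<close> are
  probabilities, this is the expectation of \<open>\<Prod> r (k\<^sub>i)\<close>, where \<open>k\<^sub>i\<close> is the number of those among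
  \<open>m\<close> independent balls which fall into urn \<open>i\<close>, urn \<open>i\<close> being chosen with probability \<open>x\<^sub>i\<close>.
\<close>
definition occ :: "(nat \<Rightarrow> real) \<Rightarrow> ('i \<Rightarrow> real) \<Rightarrow> 'i set \<Rightarrow> nat \<Rightarrow> real" where
  "occ r x I m = fact m * (\<Prod>i\<in>I. egf (\<lambda>k. r k * x i ^ k)) $ m"

lemma occ_empty: "occ r x {} m = (if m = 0 then 1 else 0)"
  by (simp add: occ_def)

text \<open>
  Conditioning on how many of the \<open>m\<close> balls miss the urn \<open>i\<close>. Almost all later facts about
  occupancy sums are inductions along this recursion.
\<close>
lemma occ_insert:
  assumes "finite I" "i \<notin> I"
  shows "occ r x (insert i I) m
           = (\<Sum>j\<le>m. real (m choose j) * occ r x I j * (r (m - j) * x i ^ (m - j)))"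
proof -
  let ?P = "\<Prod>i\<in>I. egf (\<lambda>k. r k * x i ^ k)"
  have "occ r x (insert i I) m = fact m * (?P * egf (\<lambda>k. r k * x i ^ k)) $ m"
    using assms by (simp add: occ_def mult.commute)
  also have "\<dots> = (\<Sum>j=0..m. fact m * (?P $ j * (r (m - j) * x i ^ (m - j) / fact (m - j))))"
    by (simp add: fps_mult_nth sum_distrib_left egf_def)
  also have "\<dots> = (\<Sum>j\<le>m. real (m choose j) * occ r x I j * (r (m - j) * x i ^ (m - j)))"
    unfolding atMost_atLeast0
    by (rule sum.cong[OF refl]) (simp add: occ_def binomial_fact mult_ac)
  finally show ?thesis .
qed

lemma occ_degree_1:
  assumes "finite I" "r 0 = 1"
  shows "occ r x I 1 = r 1 * (\<Sum>i\<in>I. x i)"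
proof -
  have "occ r x I 0 = 1 \<and> occ r x I 1 = r 1 * (\<Sum>i\<in>I. x i)"
    using assms(1)
    by (induction I rule: finite_induct) (auto simp: occ_empty occ_insert assms(2) algebra_simps)
  then show ?thesis ..
qed

lemma occ_one:
  assumes "finite I"
  shows "occ (\<lambda>_. 1) x I m = (\<Sum>i\<in>I. x i) ^ m"
  using assms
proof (induction I arbitrary: m)
  case empty
  then show ?case by (simp add: occ_empty power_0_left)
next
  case (insert i I)
  then show ?case
    by (simp add: occ_insert add.commute[of "x i"] binomial_ring)
qed

lemma occ_scale:
  assumes "finite I"
  shows "occ (\<lambda>k. c ^ k * s k) x I m = c ^ m * occ s x I m"
  using assms
proof (induction I arbitrary: m)
  case empty
  then show ?case by (simp add: occ_empty)
next
  case (insert i I)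
  show ?case
    unfolding occ_insert[OF insert.hyps(1,2)] insert.IH sum_distrib_left
  proof (rule sum.cong[OF refl])
    fix j assume "j \<in> {..m}"
    then have "c ^ m = c ^ j * c ^ (m - j)"
      by (simp flip: power_add)
    then show "real (m choose j) * (c ^ j * occ s x I j) * (c ^ (m - j) * s (m - j) * x i ^ (m - j))
      = c ^ m * (real (m choose j) * occ s x I j * (s (m - j) * x i ^ (m - j)))"
      by simp
  qed
qed

lemma occ_mono:
  assumes "finite I" "\<And>i. i \<in> I \<Longrightarrow> 0 \<le> x i" "\<And>k. 0 \<le> s k" "\<And>k. s k \<le> t k"
  shows "0 \<le> occ s x I m \<and> occ s x I m \<le> occ t x I m"
  using assms(1,2)
proof (induction I arbitrary: m)
  case empty
  then show ?case by (simp add: occ_empty)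
next
  case (insert i I)
  have IH: "0 \<le> occ s x I j" "occ s x I j \<le> occ t x I j" for j
    using insert by auto
  have t: "0 \<le> t k" for k using assms(3,4)[of k] by linarith
  have x: "0 \<le> x i" using insert.prems by simp
  show ?case
    unfolding occ_insert[OF insert.hyps(1,2)]
    using x IH assms(3,4) t
    by (auto intro!: sum_nonneg sum_mono mult_mono mult_left_mono mult_right_mono mult_nonneg_nonneg
        intro: order_trans)
qed

text \<open>
  With these weights the occupancy sum is the probability that the \<open>m\<close> balls fall into distinct
  urns, which is \<open>m!\<close> times the \<open>m\<close>-th elementary symmetric polynomial of the \<open>x\<^sub>i\<close>.
\<close>
definition inj_weight :: "nat \<Rightarrow> real" where
  "inj_weight k = (if k \<le> 1 then 1 else 0)"

lemma inj_weight_cases: "inj_weight k = 0 \<or> inj_weight k = 1"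
  by (simp add: inj_weight_def)

lemma occ_inj_bounds:
  assumes "finite I" "\<And>i. i \<in> I \<Longrightarrow> 0 \<le> x i"
  shows "0 \<le> occ inj_weight x I m" "occ inj_weight x I m \<le> (\<Sum>i\<in>I. x i) ^ m"
  using occ_mono[of I x inj_weight "\<lambda>_. 1" m] assms occ_one[of I x m]
  by (auto simp: inj_weight_def)

section \<open>Replacing the weights of collisions by a constant\<close>

text \<open>
  The induction step of the comparison below, for one value of the number of balls that miss the
  new urn. Here \<open>D\<close> is the collision-free part of the total mass \<open>S\<close> and \<open>d\<close> tells whether the new
  urn is free of collisions. If it is not, then all of \<open>S\<close> becomes collisional and has weight
  \<open>\<rho>\<close>; collisions elsewhere would only contribute further factors \<open>\<rho> \<le> 1\<close>.
\<close>
lemma two_value_split_mult_le: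
  fixes A D S s d \<rho> :: real
  assumes "0 \<le> D" "D \<le> S" "0 \<le> s" "0 \<le> \<rho>" "\<rho> \<le> 1" "d = 0 \<or> d = 1"
    and "A \<le> D + \<rho> * (S - D)" and "s \<le> d + \<rho> * (1 - d)"
  shows "A * s \<le> D * d + \<rho> * (S - D * d)"
proof -
  have nn: "0 \<le> D + \<rho> * (S - D)" using assms by simp
  have "A * s \<le> (D + \<rho> * (S - D)) * (d + \<rho> * (1 - d))"
    using assms nn by (intro mult_mono) auto
  moreover have "\<rho> * (S - D) \<le> 1 * (S - D)"
    using assms by (intro mult_right_mono) auto
  then have "\<rho> * (D + \<rho> * (S - D)) \<le> \<rho> * S"
    using assms by (intro mult_left_mono) auto
  ultimately show ?thesis
    using assms(6) by (auto simp: algebra_simps)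
qed

lemma two_value_split_mult_ge:
  fixes A D S s d \<rho> :: real
  assumes "0 \<le> D" "D \<le> S" "1 \<le> \<rho>" "d = 0 \<or> d = 1"
    and "D + \<rho> * (S - D) \<le> A" and "d + \<rho> * (1 - d) \<le> s"
  shows "D * d + \<rho> * (S - D * d) \<le> A * s"
proof -
  have nn: "0 \<le> D + \<rho> * (S - D)" "0 \<le> d + \<rho> * (1 - d)" using assms by auto
  then have A: "0 \<le> A" using assms by linarith
  have "(D + \<rho> * (S - D)) * (d + \<rho> * (1 - d)) \<le> A * s"
    using assms nn A by (intro mult_mono) auto
  moreover have "1 * (S - D) \<le> \<rho> * (S - D)"
    using assms by (intro mult_right_mono) auto
  then have "\<rho> * S \<le> \<rho> * (D + \<rho> * (S - D))"
    using assms by (intro mult_left_mono) auto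
  ultimately show ?thesis
    using assms(4) by (auto simp: algebra_simps)
qed

lemma occ_split_insert:
  fixes x :: "'i \<Rightarrow> real"
  assumes "finite I" "i \<notin> I"
  defines "c \<equiv> \<lambda>m j. real (m choose j) * x i ^ (m - j)"
  shows "occ inj_weight x (insert i I) m
           + \<rho> * ((\<Sum>i\<in>insert i I. x i) ^ m - occ inj_weight x (insert i I) m)
         = (\<Sum>j\<le>m. c m j * (occ inj_weight x I j * inj_weight (m - j)
             + \<rho> * ((\<Sum>i\<in>I. x i) ^ j - occ inj_weight x I j * inj_weight (m - j))))"
proof -
  have 1: "occ inj_weight x (insert i I) m
    = (\<Sum>j\<le>m. c m j * (occ inj_weight x I j * inj_weight (m - j)))"
    unfolding occ_insert[OF assms(1,2)] c_def by (rule sum.cong) auto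
  have 2: "(\<Sum>i\<in>insert i I. x i) ^ m = (\<Sum>j\<le>m. c m j * (\<Sum>i\<in>I. x i) ^ j)"
    using assms(1,2)
    by (simp add: c_def add.commute[of "x i"] binomial_ring mult_ac)
  show ?thesis
    unfolding 1 2
    by (simp add: sum_distrib_left sum_subtractf[symmetric] sum.distrib[symmetric] algebra_simps)
qed

text \<open>
  If an urn with several balls has weight at most \<open>\<rho> \<le> 1\<close> and every other urn has weight at most
  one, then a configuration with a collision has weight at most \<open>\<rho>\<close>, because one such urn suffices.
  So the occupancy sum is at most the collision-free mass plus \<open>\<rho>\<close> times the mass of the collisions.
\<close>
lemma occ_le_split:
  assumes "finite I" "\<And>i. i \<in> I \<Longrightarrow> 0 \<le> x i"
    and s: "\<And>k. 0 \<le> s k" "\<And>k. s k \<le> inj_weight k + \<rho> * (1 - inj_weight k)"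
    and \<rho>: "0 \<le> \<rho>" "\<rho> \<le> 1"
  shows "occ s x I m \<le> occ inj_weight x I m + \<rho> * ((\<Sum>i\<in>I. x i) ^ m - occ inj_weight x I m)"
  using assms(1,2)
proof (induction I arbitrary: m)
  case empty
  then show ?case by (simp add: occ_empty power_0_left)
next
  case (insert i I)
  have "occ s x (insert i I) m
    = (\<Sum>j\<le>m. real (m choose j) * x i ^ (m - j) * (occ s x I j * s (m - j)))"
    unfolding occ_insert[OF insert.hyps(1,2)] by (rule sum.cong) auto
  also have "\<dots> \<le> (\<Sum>j\<le>m. real (m choose j) * x i ^ (m - j)
      * (occ inj_weight x I j * inj_weight (m - j)
             + \<rho> * ((\<Sum>i\<in>I. x i) ^ j - occ inj_weight x I j * inj_weight (m - j))))"
    using insert occ_inj_bounds[of I x] s \<rho> inj_weight_cases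
    by (intro sum_mono mult_left_mono two_value_split_mult_le) auto
  finally show ?case
    unfolding occ_split_insert[OF insert.hyps(1,2)] .
qed

lemma occ_ge_split:
  assumes "finite I" "\<And>i. i \<in> I \<Longrightarrow> 0 \<le> x i"
    and s: "\<And>k. inj_weight k + \<rho> * (1 - inj_weight k) \<le> s k"
    and \<rho>: "1 \<le> \<rho>"
  shows "occ inj_weight x I m + \<rho> * ((\<Sum>i\<in>I. x i) ^ m - occ inj_weight x I m) \<le> occ s x I m"
  using assms(1,2)
proof (induction I arbitrary: m)
  case empty
  then show ?case by (simp add: occ_empty power_0_left)
next
  case (insert i I)
  have "(\<Sum>j\<le>m. real (m choose j) * x i ^ (m - j)
      * (occ inj_weight x I j * inj_weight (m - j)
             + \<rho> * ((\<Sum>i\<in>I. x i) ^ j - occ inj_weight x I j * inj_weight (m - j))))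
     \<le> (\<Sum>j\<le>m. real (m choose j) * x i ^ (m - j) * (occ s x I j * s (m - j)))"
    using insert occ_inj_bounds[of I x] s \<rho> inj_weight_cases
    by (intro sum_mono mult_left_mono two_value_split_mult_ge) auto
  also have "\<dots> = occ s x (insert i I) m"
    unfolding occ_insert[OF insert.hyps(1,2)] by (rule sum.cong) auto
  finally show ?case
    unfolding occ_split_insert[OF insert.hyps(1,2)] .
qed

section \<open>The inequalities of Newton and Maclaurin\<close>

lemma occ_inj_0: "finite I \<Longrightarrow> occ inj_weight x I 0 = 1"
  by (induction I rule: finite_induct) (auto simp: occ_empty occ_insert inj_weight_def)

lemma occ_inj_insert_Suc:
  assumes "finite I" "i \<notin> I"
  shows "occ inj_weight x (insert i I) (Suc m)
    = occ inj_weight x I (Suc m) + real (Suc m) * x i * occ inj_weight x I m"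
proof -
  have "(\<Sum>j<m. real (Suc m choose j) * occ inj_weight x I j * (inj_weight (Suc m - j) * x i ^ (Suc m - j))) = 0"
    by (rule sum.neutral) (auto simp: inj_weight_def)
  then show ?thesis
    unfolding occ_insert[OF assms]
    by (simp add: lessThan_Suc_atMost[symmetric] inj_weight_def del: binomial_Suc_Suc)
qed

lemma occ_inj_eq_0:
  assumes "finite I" "card I < m"
  shows "occ inj_weight x I m = 0"
  using assms
proof (induction I arbitrary: m)
  case empty
  then show ?case by (simp add: occ_empty)
next
  case (insert i I)
  then obtain k where "m = Suc k" by (cases m) auto
  with insert show ?case by (simp add: occ_inj_insert_Suc del: of_nat_Suc)
qed

lemma occ_inj_eq_0_Suc:
  assumes "finite I" "\<And>i. i \<in> I \<Longrightarrow> 0 \<le> x i" "occ inj_weight x I m = 0"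
  shows "occ inj_weight x I (Suc m) = 0"
  using assms
proof (induction I arbitrary: m)
  case empty
  then show ?case by (simp add: occ_empty)
next
  case (insert i I)
  then obtain k where m: "m = Suc k" by (cases m) (auto simp: occ_inj_0)
  have "0 \<le> occ inj_weight x I j" for j
    using insert by (intro occ_inj_bounds) auto
  moreover have "0 \<le> real (Suc k) * x i * occ inj_weight x I k"
    using insert calculation by (intro mult_nonneg_nonneg) auto
  ultimately have "occ inj_weight x I (Suc k) = 0"
    using insert.prems(2) insert.hyps unfolding m
    by (simp add: occ_inj_insert_Suc add_nonneg_eq_0_iff del: of_nat_Suc)
  with insert show ?case
    by (simp add: occ_inj_insert_Suc m del: of_nat_Suc)
qed

lemma occ_inj_2:
  assumes "finite I"
  shows "occ inj_weight x I 2 = (\<Sum>i\<in>I. x i)\<^sup>2 - (\<Sum>i\<in>I. (x i)\<^sup>2)"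
  using assms
proof (induction I)
  case empty
  then show ?case by (simp add: occ_empty)
next
  case (insert i I)
  have w: "inj_weight 0 = 1" "inj_weight 1 = 1" by (simp_all add: inj_weight_def)
  have 1: "occ inj_weight x I 1 = (\<Sum>i\<in>I. x i)"
    using occ_degree_1[where r = inj_weight, OF insert.hyps(1) w(1)] w(2) by simp
  show ?case
    using insert occ_inj_insert_Suc[OF insert.hyps(1,2), of x 1] 1
    by (simp add: numeral_2_eq_2 power2_eq_square algebra_simps)
qed

text \<open>
  The elementary symmetric polynomial divided by its number of terms. For \<open>k > card I\<close> it is
  \<open>0 / 0 = 0\<close>, which is the value that keeps Newton's inequality true there.
\<close>
definition esym_mean :: "('i \<Rightarrow> real) \<Rightarrow> 'i set \<Rightarrow> nat \<Rightarrow> real" where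
  "esym_mean x I k = occ inj_weight x I k / (fact k * real (card I choose k))"

lemma esym_mean_0: "finite I \<Longrightarrow> esym_mean x I 0 = 1"
  by (simp add: esym_mean_def occ_inj_0)

lemma occ_inj_eq_esym_mean:
  assumes "finite I"
  shows "occ inj_weight x I k = fact k * real (card I choose k) * esym_mean x I k"
  using assms occ_inj_eq_0[of I k x] by (cases "k \<le> card I") (auto simp: esym_mean_def)

lemma esym_mean_nonneg:
  assumes "finite I" "\<And>i. i \<in> I \<Longrightarrow> 0 \<le> x i"
  shows "0 \<le> esym_mean x I k"
  using occ_inj_bounds(1)[of I x k] assms by (simp add: esym_mean_def)

lemma esym_mean_eq_0_Suc:
  assumes "finite I" "\<And>i. i \<in> I \<Longrightarrow> 0 \<le> x i" "esym_mean x I k = 0"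
  shows "esym_mean x I (Suc k) = 0"
proof -
  have "occ inj_weight x I k = 0"
    using assms occ_inj_eq_esym_mean by fastforce
  then show ?thesis
    using occ_inj_eq_0_Suc[of I x k] assms by (simp add: esym_mean_def)
qed

lemma esym_mean_insert:
  assumes "finite I" "i \<notin> I" and "k \<le> Suc (card I)"
  shows "real (Suc (card I)) * esym_mean x (insert i I) k
    = (real (Suc (card I)) - real k) * esym_mean x I k + real k * x i * esym_mean x I (k - 1)"
proof (cases k)
  case 0
  then show ?thesis using assms by (simp add: esym_mean_0)
next
  case (Suc l)
  define n where "n = card I"
  have l: "l \<le> n" using assms Suc n_def by simp
  have B: "real (Suc n choose Suc l) * real (Suc l) = real (Suc n) * real (n choose l)"
    by (metis Suc_times_binomial of_nat_mult mult.commute)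
  have C: "real (n choose Suc l) * real (Suc l) = real (n choose l) * (real n - real l)"
  proof -
    have "Suc l * (n choose Suc l) = (n choose l) * (n - l)"
      using binomial_absorption[of l n] binomial_absorb_comp[of n l] by (simp only: mult.commute)
    then have "real (Suc l) * real (n choose Suc l) = real (n choose l) * real (n - l)"
      by (metis of_nat_mult)
    then show ?thesis using l by (simp add: of_nat_diff mult.commute)
  qed
  have pos: "real (n choose l) > 0" using l by simp
  have ci: "card (insert i I) = Suc n" using assms by (simp add: n_def)
  let ?p = "esym_mean x I" and ?p' = "esym_mean x (insert i I)"
  have "fact (Suc l) * real (Suc n choose Suc l) * ?p' (Suc l)
     = fact (Suc l) * real (n choose Suc l) * ?p (Suc l)
       + real (Suc l) * x i * (fact l * real (n choose l) * ?p l)"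
    using occ_inj_insert_Suc[OF assms(1,2), of x l]
    using assms(1) unfolding occ_inj_eq_esym_mean[OF assms(1)]
    by (simp add: occ_inj_eq_esym_mean ci n_def del: of_nat_Suc binomial_Suc_Suc fact_Suc)
  then have "fact (Suc l) * (real (Suc n choose Suc l) * ?p' (Suc l))
     = fact (Suc l) * (real (n choose Suc l) * ?p (Suc l) + x i * (real (n choose l) * ?p l))"
    by (simp add: algebra_simps del: binomial_Suc_Suc)
  then have "real (Suc n choose Suc l) * ?p' (Suc l)
     = real (n choose Suc l) * ?p (Suc l) + x i * (real (n choose l) * ?p l)"
    by (simp del: binomial_Suc_Suc fact_Suc)
  moreover have "c * (N * P') = c * (m * P + s * x * Q)"
    if "A * P' = B * P + x * (c * Q)" "A * s = N * c" "B * s = c * m"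
    for A B N P P' Q c m s x :: real
    using that by algebra
  ultimately have "real (n choose l) * (real (Suc n) * ?p' (Suc l))
     = real (n choose l) * ((real n - real l) * ?p (Suc l) + real (Suc l) * x i * ?p l)"
    using B C by blast
  with pos have "real (Suc n) * ?p' (Suc l) = (real n - real l) * ?p (Suc l) + real (Suc l) * x i * ?p l"
    by (simp only: mult_cancel_left) simp
  then show ?thesis using Suc by (simp add: n_def)
qed

text \<open>
  The step of Newton's inequality from \<open>N - 1\<close> to \<open>N\<close> variables, with \<open>m = N - k\<close>. The numbers
  \<open>a, b, c, d\<close> are the means of degrees \<open>k - 2, \<dots>, k + 1\<close> in the old variables, and \<open>x\<close> is the new
  variable. Each mixed term of the left side is bounded by one in \<open>b\<close> and \<open>c\<close> only; what is left of
  the right side is the square of \<open>c - x b\<close>. The factors \<open>k - 1\<close> in the assumptions cover the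
  case \<open>k = 1\<close>, in which there is no mean of degree \<open>k - 2\<close>.
\<close>
lemma newton_step:
  fixes a b c d x m k :: real
  assumes "1 \<le> k" "1 \<le> m" "0 \<le> x"
    and bd: "b * d \<le> c\<^sup>2"
    and ac: "(k - 1) * (a * c) \<le> (k - 1) * b\<^sup>2" and ad: "(k - 1) * (a * d) \<le> (k - 1) * (b * c)"
  shows "((m + 1) * b + (k - 1) * x * a) * ((m - 1) * d + (k + 1) * x * c) \<le> (m * c + k * x * b)\<^sup>2"
proof -
  have 1: "(m\<^sup>2 - 1) * (b * d) \<le> (m\<^sup>2 - 1) * c\<^sup>2"
    using bd assms by (intro mult_left_mono) auto
  have 2: "((k + 1) * x\<^sup>2) * ((k - 1) * (a * c)) \<le> ((k + 1) * x\<^sup>2) * ((k - 1) * b\<^sup>2)"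
    by (rule mult_left_mono[OF ac]) (use assms in simp)
  have 3: "((m - 1) * x) * ((k - 1) * (a * d)) \<le> ((m - 1) * x) * ((k - 1) * (b * c))"
    by (rule mult_left_mono[OF ad]) (use assms in simp)
  have "((m + 1) * b + (k - 1) * x * a) * ((m - 1) * d + (k + 1) * x * c)
    = (m\<^sup>2 - 1) * (b * d) + ((k + 1) * x\<^sup>2) * ((k - 1) * (a * c))
      + ((m - 1) * x) * ((k - 1) * (a * d)) + (m + 1) * (k + 1) * x * (b * c)"
    by (simp add: power2_eq_square algebra_simps)
  also have "\<dots> \<le> (m\<^sup>2 - 1) * c\<^sup>2 + ((k + 1) * x\<^sup>2) * ((k - 1) * b\<^sup>2)
      + ((m - 1) * x) * ((k - 1) * (b * c)) + (m + 1) * (k + 1) * x * (b * c)"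
    using 1 2 3 by linarith
  also have "\<dots> = (m * c + k * x * b)\<^sup>2 - (c - x * b)\<^sup>2"
    by (simp add: power2_eq_square algebra_simps)
  finally show ?thesis by (smt (verit) zero_le_power2)
qed

text \<open>
  By induction on the number of variables. The step also needs
  \<open>p\<^sub>l p\<^bsub>l+3\<^esub> \<le> p\<^bsub>l+1\<^esub> p\<^bsub>l+2\<^esub>\<close>, which is the product of two instances of the induction hypothesis
  after cancelling \<open>p\<^bsub>l+1\<^esub> p\<^bsub>l+2\<^esub>\<close>; if this factor vanishes, then so does \<open>p\<^bsub>l+3\<^esub>\<close>.
\<close>
lemma newton_inequality:
  assumes "finite I" "\<And>i. i \<in> I \<Longrightarrow> 0 \<le> x i"
  shows "esym_mean x I k * esym_mean x I (k + 2) \<le> (esym_mean x I (k + 1))\<^sup>2"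
  using assms
proof (induction I arbitrary: k)
  case empty
  then show ?case by (simp add: esym_mean_def)
next
  case (insert i I)
  let ?p = "esym_mean x I"
  define N where "N = real (Suc (card I))"
  show ?case
  proof (cases "k + 2 \<le> Suc (card I)")
    case False
    then have "esym_mean x (insert i I) (k + 2) = 0"
      using insert.hyps by (simp add: esym_mean_def occ_inj_eq_0)
    then show ?thesis by simp
  next
    case True
    have nn: "0 \<le> ?p j" for j using insert by (intro esym_mean_nonneg) auto
    have IH: "?p j * ?p (j + 2) \<le> (?p (j + 1))\<^sup>2" for j
      using insert by auto
    have z: "?p j = 0 \<Longrightarrow> ?p (Suc j) = 0" for j
      using insert by (intro esym_mean_eq_0_Suc) auto
    have bd: "?p k * ?p (k + 2) \<le> (?p (k + 1))\<^sup>2" by (rule IH)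
    have ac: "real k * (?p (k - 1) * ?p (k + 1)) \<le> real k * (?p k)\<^sup>2"
      using IH[of "k - 1"] by (cases k) (auto intro!: mult_left_mono)
    have ad: "real k * (?p (k - 1) * ?p (k + 2)) \<le> real k * (?p k * ?p (k + 1))"
    proof (cases k)
      case (Suc l)
      have "?p l * ?p (l + 3) \<le> ?p (l + 1) * ?p (l + 2)"
      proof (cases "?p (l + 2) = 0 \<or> ?p (l + 1) = 0")
        case True
        then have "?p (l + 3) = 0" using z[of "l + 1"] z[of "l + 2"] by (auto simp: eval_nat_numeral)
        then show ?thesis using nn by simp
      next
        case False
        then have pos: "0 < ?p (l + 1) * ?p (l + 2)"
          using nn[of "l + 1"] nn[of "l + 2"] by simp
        have "(?p l * ?p (l + 2)) * (?p (l + 1) * ?p (l + 3)) \<le> (?p (l + 1))\<^sup>2 * (?p (l + 2))\<^sup>2"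
          using IH[of l] IH[of "l + 1"] nn
          by (intro mult_mono) (auto simp: eval_nat_numeral)
        then have "(?p l * ?p (l + 3)) * (?p (l + 1) * ?p (l + 2)) \<le> (?p (l + 1) * ?p (l + 2)) * (?p (l + 1) * ?p (l + 2))"
          by (simp add: power2_eq_square mult_ac)
        then show ?thesis using pos by (rule mult_right_le_imp_le)
      qed
      then show ?thesis using Suc by (auto intro!: mult_left_mono simp: eval_nat_numeral)
    qed simp
    have e: "N * esym_mean x (insert i I) j = (N - real j) * ?p j + real j * x i * ?p (j - 1)"
      if "j \<le> k + 2" for j
      unfolding N_def using that True insert.hyps by (intro esym_mean_insert) auto
    define m K where "m = N - real (k + 1)" and "K = real (k + 1)"
    have e0: "N * esym_mean x (insert i I) k = (m + 1) * ?p k + (K - 1) * x i * ?p (k - 1)"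
      using e[of "k"] by (simp add: m_def K_def)
    have e1: "N * esym_mean x (insert i I) (k + 1) = m * ?p (k + 1) + K * x i * ?p k"
      using e[of "k + 1"] by (simp add: m_def K_def)
    have e2: "N * esym_mean x (insert i I) (k + 2) = (m - 1) * ?p (k + 2) + (K + 1) * x i * ?p (k + 1)"
      using e[of "k + 2"] by (simp add: m_def K_def)
    have "1 \<le> m" using True by (simp add: m_def N_def)
    moreover have "1 \<le> K" by (simp add: K_def)
    ultimately have "(N * esym_mean x (insert i I) k) * (N * esym_mean x (insert i I) (k + 2))
      \<le> (N * esym_mean x (insert i I) (k + 1))\<^sup>2"
      unfolding e0 e1 e2 using bd ac ad insert.prems
      by (intro newton_step) (auto simp: K_def)
    then have "(N * N) * (esym_mean x (insert i I) k * esym_mean x (insert i I) (k + 2))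
      \<le> (N * N) * (esym_mean x (insert i I) (k + 1))\<^sup>2"
      by (simp only: power2_eq_square mult.assoc mult.left_commute)
    moreover have "0 < N * N" by (simp add: N_def)
    ultimately show ?thesis by (rule mult_left_le_imp_le)
  qed
qed

text \<open>
  For positive \<open>u\<close> this says that the \<open>k\<close>-th root of \<open>u k\<close> is non-increasing in \<open>k \<ge> 1\<close>. The vanishing
  condition excludes log-concave sequences with internal zeros such as \<open>1, 0, 0, 1\<close>, for which the
  conclusion fails.
\<close>
lemma maclaurin_step:
  fixes u :: "nat \<Rightarrow> real"
  assumes "u 0 = 1" "\<And>k. 0 \<le> u k" and lc: "\<And>k. u k * u (k + 2) \<le> (u (k + 1))\<^sup>2"
    and zero: "\<And>k. u k = 0 \<Longrightarrow> u (Suc k) = 0"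
  shows "u (Suc k) ^ k \<le> u k ^ Suc k"
proof (induction k)
  case 0
  then show ?case using assms by simp
next
  case (Suc k)
  show ?case
  proof (cases "u (Suc k) = 0")
    case True
    then show ?thesis using zero[of "Suc k"] by simp
  next
    case False
    then have pos: "0 < u (Suc k)" using assms(2)[of "Suc k"] by linarith
    have "u (Suc k) ^ k * u (Suc (Suc k)) ^ Suc k \<le> u k ^ Suc k * u (Suc (Suc k)) ^ Suc k"
      using Suc assms(2) by (intro mult_right_mono) auto
    also have "\<dots> = (u k * u (k + 2)) ^ Suc k"
      by (simp add: power_mult_distrib)
    also have "\<dots> \<le> ((u (Suc k))\<^sup>2) ^ Suc k"
      using lc[of k] assms(2) by (intro power_mono) auto
    also have "\<dots> = u (Suc k) ^ k * u (Suc k) ^ Suc (Suc k)"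
      by (simp flip: power_mult power_add add: mult_2)
    finally show ?thesis using pos by (simp add: mult_le_cancel_left_pos)
  qed
qed

lemma maclaurin_two:
  fixes u :: "nat \<Rightarrow> real"
  assumes "u 0 = 1" "\<And>k. 0 \<le> u k" and lc: "\<And>k. u k * u (k + 2) \<le> (u (k + 1))\<^sup>2"
    and zero: "\<And>k. u k = 0 \<Longrightarrow> u (Suc k) = 0"
    and "2 \<le> q"
  shows "(u q)\<^sup>2 \<le> u 2 ^ q"
  using \<open>2 \<le> q\<close>
proof (induction q rule: dec_induct)
  case base
  then show ?case by simp
next
  case (step q)
  have "((u (Suc q))\<^sup>2) ^ q = (u (Suc q) ^ q)\<^sup>2"
    by (simp flip: power_mult add: mult.commute)
  also have "\<dots> \<le> (u q ^ Suc q)\<^sup>2"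
    using maclaurin_step[of u q] assms by (intro power_mono) auto
  also have "\<dots> = ((u q)\<^sup>2) ^ Suc q"
    by (simp only: power_mult[symmetric] mult.commute)
  also have "\<dots> \<le> (u 2 ^ q) ^ Suc q"
    using step by (intro power_mono) auto
  also have "\<dots> = (u 2 ^ Suc q) ^ q"
    by (simp only: power_mult[symmetric] mult.commute)
  finally show ?case
    using step assms(2) by (subst (asm) power_mono_iff) auto
qed

lemma occ_inj_le_Maclaurin:
  assumes "finite I" "\<And>i. i \<in> I \<Longrightarrow> 0 \<le> x i" "2 \<le> q" "q \<le> card I"
  shows "occ inj_weight x I q \<le> fact q * real (card I choose q)
    * (((\<Sum>i\<in>I. x i)\<^sup>2 - (\<Sum>i\<in>I. (x i)\<^sup>2)) / (real (card I) * (real (card I) - 1))) powr (real q / 2)"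
proof -
  let ?p = "esym_mean x I"
  have nn: "0 \<le> ?p k" for k using assms by (intro esym_mean_nonneg) auto
  have c2: "fact 2 * real (card I choose 2) = real (card I) * (real (card I) - 1)"
  proof -
    have "2 dvd card I * (card I - 1)" by (cases "even (card I)") auto
    then show ?thesis
      using assms by (simp add: choose_two real_of_nat_div of_nat_diff)
  qed
  have p2: "?p 2 = ((\<Sum>i\<in>I. x i)\<^sup>2 - (\<Sum>i\<in>I. (x i)\<^sup>2)) / (real (card I) * (real (card I) - 1))"
    unfolding esym_mean_def occ_inj_2[OF assms(1)] c2 ..
  have "(?p q)\<^sup>2 \<le> ?p 2 ^ q"
    by (rule maclaurin_two[OF esym_mean_0[OF assms(1)] nn newton_inequality[OF assms(1,2)]
          esym_mean_eq_0_Suc[OF assms(1,2)] assms(3)])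
  also have "\<dots> = (?p 2 powr (real q / 2))\<^sup>2"
    using nn[of 2] \<open>2 \<le> q\<close> by (simp add: power2_eq_square powr_realpow' flip: powr_add)
  finally have "?p q \<le> ?p 2 powr (real q / 2)"
    by (rule power2_le_imp_le) simp
  then show ?thesis
    unfolding occ_inj_eq_esym_mean[OF assms(1)] p2 by (intro mult_left_mono) auto
qed

section \<open>Occupancy sums with equal probabilities\<close>

text \<open>
  Since \<open>F - 1\<close> starts in degree one, only powers up to \<open>q\<close> matter. So for fixed \<open>q\<close> the coefficient
  is a polynomial in \<open>n\<close>, written here in the basis of the binomial coefficients.
\<close>
lemma fps_power_nth_expansion:
  fixes F :: "real fps"
  assumes "F $ 0 = 1"
  shows "(F ^ n) $ q = (\<Sum>k\<le>q. real (n choose k) * ((F - 1) ^ k) $ q)"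
proof -
  have z: "((F - 1) ^ k) $ q = 0" if "q < k" for k
    using startsby_zero_power_prefix[of "F - 1" k] assms that by simp
  have "F ^ n = (\<Sum>k\<le>n. of_nat (n choose k) * (F - 1) ^ k)"
    using binomial_ring[of "F - 1" 1 n] by simp
  then have "(F ^ n) $ q = (\<Sum>k\<le>n. real (n choose k) * ((F - 1) ^ k) $ q)"
    by (simp add: fps_sum_nth fps_of_nat[symmetric] fps_mult_left_const_nth del: fps_of_nat)
  also have "\<dots> = (\<Sum>k\<le>max n q. real (n choose k) * ((F - 1) ^ k) $ q)"
    by (rule sum.mono_neutral_left) (auto simp: binomial_eq_0)
  also have "\<dots> = (\<Sum>k\<le>q. real (n choose k) * ((F - 1) ^ k) $ q)"
    by (rule sum.mono_neutral_right) (auto simp: z)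
  finally show ?thesis .
qed

lemma fps_power_nth_Suc:
  fixes B :: "real fps"
  assumes "B $ 0 = 0"
  shows "(B ^ k) $ Suc k = real k * (B $ 1) ^ (k - 1) * B $ 2"
proof (induction k)
  case 0
  then show ?case by simp
next
  case (Suc k)
  have z: "(B ^ k) $ i = 0" if "i < k" for i
    using startsby_zero_power_prefix[OF assms, of k] that by simp
  have "(B ^ Suc k) $ Suc (Suc k) = (\<Sum>i=0..Suc (Suc k). (B ^ k) $ i * B $ (Suc (Suc k) - i))"
    unfolding power_Suc2 by (rule fps_mult_nth)
  also have "\<dots> = (\<Sum>i\<in>{k, Suc k}. (B ^ k) $ i * B $ (Suc (Suc k) - i))"
    using assms z by (intro sum.mono_neutral_right) (auto, metis le_SucE le_antisym not_less_eq_eq diff_self_eq_0 not_le)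
  also have "\<dots> = (B $ 1) ^ k * B $ 2 + real k * (B $ 1) ^ (k - 1) * B $ 2 * B $ 1"
    using Suc startsby_zero_power_nth_same[OF assms, of k] by (simp add: Suc_diff_le numeral_2_eq_2)
  also have "\<dots> = real (Suc k) * (B $ 1) ^ (Suc k - 1) * B $ 2"
    by (cases k) (simp_all add: algebra_simps)
  finally show ?case .
qed

lemma occ_uniform:
  assumes "finite I" "r 0 = 1"
  shows "occ r (\<lambda>_. y) I q
    = fact q * y ^ q * (\<Sum>k\<le>q. real (card I choose k) * ((egf r - 1) ^ k) $ q)"
proof -
  have "egf (\<lambda>k. r k * y ^ k) = egf r oo (fps_const y * fps_X)"
    by (simp add: fps_compose_linear egf_def) (simp add: mult.commute)
  then have "(\<Prod>i\<in>I. egf (\<lambda>k. r k * y ^ k)) = egf r ^ card I oo (fps_const y * fps_X)"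
    by (simp add: fps_compose_power)
  then show ?thesis
    using fps_power_nth_expansion[of "egf r" "card I" q] assms by (simp add: occ_def egf_def)
qed

lemma occ_inj_uniform:
  assumes "finite I"
  shows "occ inj_weight (\<lambda>_. y) I q = fact q * y ^ q * real (card I choose q)"
proof -
  have "egf inj_weight - 1 = fps_X"
    by (rule fps_ext) (auto simp: egf_def inj_weight_def fps_X_def)
  then have "(\<Sum>k\<le>q. real (card I choose k) * ((egf inj_weight - 1) ^ k) $ q) = (\<Sum>k\<le>q. if k = q then real (card I choose q) else 0)"
    by (intro sum.cong) (auto simp: fps_X_power_nth)
  then show ?thesis
    using occ_uniform[OF assms, of inj_weight y q] by (simp add: inj_weight_def)
qed

text \<open>
  By the expansion above, the occupancy sum with \<open>n\<close> equal probabilities is a combination of the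
  numbers \<open>(n choose k) / n ^ q\<close> with \<open>k \<le> q\<close>, and those with \<open>k \<le> q - 2\<close> are \<open>O(1 / n\<^sup>2)\<close>. The term
  \<open>k = q\<close> comes from configurations without a collision and the term \<open>k = q - 1\<close> from those with
  exactly one pair of balls in a common urn. For these the weights \<open>r 1 ^ q\<close> and
  \<open>r 1 ^ (q - 2) * r 2\<close> are exact, so both terms cancel. Expanding the constant \<open>1\<close> in the same
  way, as the occupancy sum with weights one, avoids any explicit asymptotics of the
  probability of a collision.
\<close>
lemma occ_uniform_defect:
  fixes r :: "nat \<Rightarrow> real"
  assumes "r 0 = 1" "2 \<le> q"
  obtains C where "\<And>I. finite I \<Longrightarrow> I \<noteq> {} \<Longrightarrow>
    (let n = real (card I); D = occ inj_weight (\<lambda>_. 1 / n) I q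
     in \<bar>occ r (\<lambda>_. 1 / n) I q - r 1 ^ q * D - r 1 ^ (q - 2) * r 2 * (1 - D)\<bar> \<le> C / n\<^sup>2)"
proof -
  \<comment> \<open>\<open>g k\<close> is the coefficient of \<open>n choose k\<close> in the difference to be estimated.\<close>
  define g where "g k = ((egf r - 1) ^ k) $ q - (if k = q then r 1 ^ q else 0)
     - r 1 ^ (q - 2) * r 2 * (((egf (\<lambda>_. 1) - 1) ^ k) $ q - (if k = q then 1 else 0))" for k
  have gq: "g q = 0"
    using assms startsby_zero_power_nth_same[of "egf r - 1" q]
      startsby_zero_power_nth_same[of "egf (\<lambda>_. 1) - 1" q]
    by (simp add: g_def egf_def)
  obtain l where l: "q = Suc (Suc l)"
    using assms(2) by (metis Suc_le_D numeral_2_eq_2 old.nat.exhaust zero_le Suc_le_mono)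
  have c: "((egf r - 1) ^ Suc l) $ Suc (Suc l) = real (Suc l) * r 1 ^ l * (r 2 / 2)"
    "((egf (\<lambda>_. 1) - 1) ^ Suc l) $ Suc (Suc l) = real (Suc l) * (1 / 2)"
    using assms(1) fps_power_nth_Suc[of "egf r - 1" "Suc l"]
      fps_power_nth_Suc[of "egf (\<lambda>_. 1) - 1" "Suc l"]
    by (simp_all add: egf_def del: power_Suc)
  have gq1: "g (Suc l) = 0"
    by (simp only: g_def l c) simp
  define C where "C = fact q * (\<Sum>k\<le>q. \<bar>g k\<bar>)"
  show thesis
  proof
    fix I :: "'a set"
    assume I: "finite I" "I \<noteq> {}"
    define N where "N = card I"
    define n where "n = real N"
    have n: "1 \<le> n" using I by (simp add: n_def N_def Suc_le_eq card_gt_0_iff)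
    define D where "D = occ inj_weight (\<lambda>_. 1 / n) I q"
    have "(\<Sum>k\<le>q. real (N choose k) * (if k = q then 1 else 0)) = real (N choose q)"
      by (simp add: if_distrib cong: if_cong)
    then have D: "D = fact q * (1 / n) ^ q * (\<Sum>k\<le>q. real (N choose k) * (if k = q then 1 else 0))"
      unfolding D_def occ_inj_uniform[OF I(1)] by (simp add: N_def)
    have one: "1 = fact q * (1 / n) ^ q * (\<Sum>k\<le>q. real (N choose k) * ((egf (\<lambda>_. 1) - 1) ^ k) $ q)"
      using occ_uniform[OF I(1), of "\<lambda>_. 1" "1 / n" q] occ_one[OF I(1), of "\<lambda>_. 1 / n" q] n
      by (simp add: n_def N_def)
    define c where "c = fact q * (1 / n) ^ q"
    define b where "b k = real (N choose k)" for k
    define F where "F k = ((egf r - 1) ^ k) $ q" for k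
    define E where "E k = ((egf (\<lambda>_. 1) - 1) ^ k) $ q" for k
    define \<delta> where "\<delta> k = (if k = q then 1 else 0 :: real)" for k
    have "(\<Sum>k\<le>q. b k * g k) = (\<Sum>k\<le>q. b k * F k - r 1 ^ q * (b k * \<delta> k)
       - r 1 ^ (q - 2) * r 2 * (b k * E k - b k * \<delta> k))"
      by (rule sum.cong[OF refl]) (simp add: g_def F_def E_def \<delta>_def algebra_simps)
    then have "(\<Sum>k\<le>q. b k * g k) = (\<Sum>k\<le>q. b k * F k) - r 1 ^ q * (\<Sum>k\<le>q. b k * \<delta> k)
       - r 1 ^ (q - 2) * r 2 * ((\<Sum>k\<le>q. b k * E k) - (\<Sum>k\<le>q. b k * \<delta> k))"
      by (simp only: sum_subtractf sum_distrib_left[symmetric])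
    moreover have "occ r (\<lambda>_. 1 / n) I q = c * (\<Sum>k\<le>q. b k * F k)"
      unfolding occ_uniform[where r = r, OF I(1) assms(1)] by (simp add: c_def b_def F_def N_def)
    moreover have "D = c * (\<Sum>k\<le>q. b k * \<delta> k)" "1 = c * (\<Sum>k\<le>q. b k * E k)"
      using D one by (simp_all add: c_def b_def \<delta>_def E_def)
    moreover have "X - P * D - R * (1 - D) = c * g"
      if "g = f - P * d - R * (e - d)" "X = c * f" "D = c * d" "1 = c * e"
      for X P D R c g f d e :: real
      using that by algebra
    ultimately have "occ r (\<lambda>_. 1 / n) I q - r 1 ^ q * D - r 1 ^ (q - 2) * r 2 * (1 - D)
      = c * (\<Sum>k\<le>q. b k * g k)"
      by blast
    also have "\<bar>\<dots>\<bar> \<le> c * (\<Sum>k\<le>q. \<bar>b k * g k\<bar>)"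
    proof -
      have c0: "0 \<le> c" using n by (simp add: c_def)
      then show ?thesis
        using mult_left_mono[OF sum_abs[of "\<lambda>k. b k * g k" "{..q}"] c0]
        by (simp only: abs_mult abs_of_nonneg)
    qed
    also have "\<dots> = (\<Sum>k\<le>q. fact q * \<bar>g k\<bar> * (b k / n ^ q))"
      unfolding sum_distrib_left
      by (rule sum.cong) (auto simp: c_def abs_mult b_def power_one_over field_simps)
    \<comment> \<open>The terms \<open>k = q\<close> and \<open>k = q - 1\<close> vanish; in the others \<open>b k \<le> n ^ (q - 2)\<close>.\<close>
    also have "\<dots> \<le> (\<Sum>k\<le>q. fact q * \<bar>g k\<bar> * (1 / n\<^sup>2))"
    proof (rule sum_mono)
      fix k assume k: "k \<in> {..q}"
      show "fact q * \<bar>g k\<bar> * (b k / n ^ q) \<le> fact q * \<bar>g k\<bar> * (1 / n\<^sup>2)"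
      proof (cases "k = q \<or> k = Suc l")
        case True
        then show ?thesis using gq gq1 by auto
      next
        case False
        then have "k \<le> l" using k l by simp
        have "b k \<le> n ^ k"
        proof (cases "k \<le> N")
          case True
          then show ?thesis
            unfolding b_def n_def using binomial_le_pow[of k N] by (simp flip: of_nat_power)
        qed (use n in \<open>simp add: b_def binomial_eq_0\<close>)
        also have "\<dots> \<le> n ^ l" using n \<open>k \<le> l\<close> by (intro power_increasing) auto
        finally have "b k / n ^ q \<le> n ^ l / n ^ q" using n by (intro divide_right_mono) auto
        also have "\<dots> = 1 / n\<^sup>2" using n l by (simp add: power2_eq_square)
        finally show ?thesis by (intro mult_left_mono) auto
      qed
    qed
    also have "\<dots> = C / n\<^sup>2"
      by (simp add: C_def sum_distrib_left sum_divide_distrib)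
    finally show "let n = real (card I); D = occ inj_weight (\<lambda>_. 1 / n) I q
     in \<bar>occ r (\<lambda>_. 1 / n) I q - r 1 ^ q * D - r 1 ^ (q - 2) * r 2 * (1 - D)\<bar> \<le> C / n\<^sup>2"
      by (simp add: D_def n_def N_def)
  qed
qed

section \<open>Moments of sums of independent variables\<close>

lemma (in prob_space) moments_indep_add:
  fixes U V :: "'a \<Rightarrow> real"
  assumes indep: "indep_var borel U borel V"
    and U: "\<And>k. integrable M (\<lambda>\<omega>. U \<omega> ^ k)" and V: "\<And>k. integrable M (\<lambda>\<omega>. V \<omega> ^ k)"
  shows "integrable M (\<lambda>\<omega>. (U \<omega> + V \<omega>) ^ m)"
    and "expectation (\<lambda>\<omega>. (U \<omega> + V \<omega>) ^ m)
      = (\<Sum>k\<le>m. real (m choose k) * (expectation (\<lambda>\<omega>. V \<omega> ^ k) * expectation (\<lambda>\<omega>. U \<omega> ^ (m - k))))"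
proof -
  have ind: "indep_var borel (\<lambda>\<omega>. U \<omega> ^ k) borel (\<lambda>\<omega>. V \<omega> ^ l)" for k l
    using indep_var_compose[OF indep, of "\<lambda>t. t ^ k" borel "\<lambda>t. t ^ l" borel] by (simp add: o_def)
  have eq: "(U \<omega> + V \<omega>) ^ m = (\<Sum>k\<le>m. real (m choose k) * (U \<omega> ^ (m - k) * V \<omega> ^ k))" for \<omega>
    using binomial_ring[of "V \<omega>" "U \<omega>" m] by (simp add: add.commute mult_ac)
  have int: "integrable M (\<lambda>\<omega>. U \<omega> ^ k * V \<omega> ^ l)" for k l
    by (rule indep_var_integrable[OF ind U V])
  show "integrable M (\<lambda>\<omega>. (U \<omega> + V \<omega>) ^ m)"
    unfolding eq using int by (intro Bochner_Integration.integrable_sum) simp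
  have "expectation (\<lambda>\<omega>. (U \<omega> + V \<omega>) ^ m)
    = (\<Sum>k\<le>m. expectation (\<lambda>\<omega>. real (m choose k) * (U \<omega> ^ (m - k) * V \<omega> ^ k)))"
    unfolding eq using int by (intro Bochner_Integration.integral_sum) simp
  then show "expectation (\<lambda>\<omega>. (U \<omega> + V \<omega>) ^ m)
      = (\<Sum>k\<le>m. real (m choose k) * (expectation (\<lambda>\<omega>. V \<omega> ^ k) * expectation (\<lambda>\<omega>. U \<omega> ^ (m - k))))"
    by (simp add: indep_var_lebesgue_integral[OF ind U V]) (simp add: mult.commute)
qed

text \<open>
  Exponential generating functions of moments multiply under independence, so the moments of a
  weighted sum are occupancy sums whose weights are the common moments.
\<close>
lemma (in prob_space) moments_indep_sum:
  fixes Y :: "'i \<Rightarrow> 'a \<Rightarrow> real"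
  assumes "finite I" "indep_vars (\<lambda>_. borel) Y I"
    and int: "\<And>i k. i \<in> I \<Longrightarrow> integrable M (\<lambda>\<omega>. Y i \<omega> ^ k)"
    and mu: "\<And>i k. i \<in> I \<Longrightarrow> expectation (\<lambda>\<omega>. Y i \<omega> ^ k) = \<mu> k"
  shows "integrable M (\<lambda>\<omega>. (\<Sum>i\<in>I. a i * Y i \<omega>) ^ m)
    \<and> expectation (\<lambda>\<omega>. (\<Sum>i\<in>I. a i * Y i \<omega>) ^ m) = occ \<mu> a I m"
  using assms
proof (induction I arbitrary: m)
  case empty
  then show ?case by (simp add: occ_empty power_0_left prob_space)
next
  case (insert i I)
  let ?S = "\<lambda>\<omega>. \<Sum>i\<in>I. a i * Y i \<omega>"
  have "indep_vars (\<lambda>_. borel) Y I"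
    using insert.prems(1) by (rule indep_vars_subset) auto
  then have IH: "integrable M (\<lambda>\<omega>. ?S \<omega> ^ m)" "expectation (\<lambda>\<omega>. ?S \<omega> ^ m) = occ \<mu> a I m" for m
    using insert.IH[of m] insert.prems by auto
  have "indep_vars (\<lambda>_. borel) (\<lambda>i \<omega>. a i * Y i \<omega>) (insert i I)"
    by (rule indep_vars_compose2[OF insert.prems(1)]) simp
  then have ind: "indep_var borel (\<lambda>\<omega>. a i * Y i \<omega>) borel ?S"
    using insert.hyps by (intro indep_vars_sum) auto
  have int_i: "integrable M (\<lambda>\<omega>. (a i * Y i \<omega>) ^ k)" for k
    using insert.prems(2) by (simp add: power_mult_distrib)
  have exp_i: "expectation (\<lambda>\<omega>. (a i * Y i \<omega>) ^ k) = \<mu> k * a i ^ k" for k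
    using insert.prems(3) by (simp add: power_mult_distrib)
  show ?case
    using moments_indep_add[OF ind int_i IH(1), of m] insert.hyps
    unfolding exp_i IH(2) by (simp add: occ_insert mult.assoc)
qed

text \<open>
  If the odd weights vanish, then every generating function is a power series in the square of the
  variable, and so is their product.
  Comparing coefficients halves the degree and replaces \<open>\<mu> (2 k) / (2 k)!\<close> by \<open>r k / k!\<close>; this is
  where the normalisation of the sequence \<open>r\<close> comes from.
\<close>
lemma occ_even_moments:
  assumes "finite I" "\<And>k. odd k \<Longrightarrow> \<mu> k = 0"
    and r: "\<And>k. r k = fact k * \<mu> (2 * k) / fact (2 * k)"
  shows "occ \<mu> a I (2 * q) = fact (2 * q) / fact q * occ r (\<lambda>i. (a i)\<^sup>2) I q"
proof -
  have "egf (\<lambda>k. \<mu> k * a i ^ k) = egf (\<lambda>k. r k * (a i)\<^sup>2 ^ k) oo fps_X ^ 2" for i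
    using assms(2)
    by (auto simp: fps_eq_iff egf_def r fps_nth_compose_X_power power_mult[symmetric] elim!: evenE)
  then have "(\<Prod>i\<in>I. egf (\<lambda>k. \<mu> k * a i ^ k)) = (\<Prod>i\<in>I. egf (\<lambda>k. r k * (a i)\<^sup>2 ^ k)) oo fps_X ^ 2"
    by (simp add: fps_compose_prod_distrib)
  then show ?thesis
    by (simp add: occ_def fps_nth_compose_X_power)
qed

lemma symmetric_rv_odd_moment:
  assumes "symmetric_rv M X" "X \<in> borel_measurable M" "odd k"
  shows "(\<integral>\<omega>. X \<omega> ^ k \<partial>M) = 0"
proof -
  have "(\<integral>\<omega>. X \<omega> ^ k \<partial>M) = (\<integral>t. t ^ k \<partial>distr M borel X)"
    using assms by (simp add: integral_distr)
  also have "\<dots> = (\<integral>t. t ^ k \<partial>distr M borel (\<lambda>\<omega>. - X \<omega>))"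
    using assms by (simp add: symmetric_rv_def)
  also have "\<dots> = (\<integral>\<omega>. (- X \<omega>) ^ k \<partial>M)"
    using assms by (simp add: integral_distr)
  also have "\<dots> = - (\<integral>\<omega>. X \<omega> ^ k \<partial>M)"
    using assms by (simp add: power_minus_odd)
  finally show ?thesis by simp
qed

lemma Lp_norm_even_power:
  assumes "0 < q"
  shows "Lp_norm M (real (2 * q)) Y ^ (2 * q) = (\<integral>\<omega>. Y \<omega> ^ (2 * q) \<partial>M)"
proof -
  have "\<bar>Y \<omega>\<bar> powr real (2 * q) = Y \<omega> ^ (2 * q)" for \<omega>
    using assms powr_realpow'[of "\<bar>Y \<omega>\<bar>" "2 * q"] by (simp add: power_even_abs)
  moreover have "0 \<le> (\<integral>\<omega>. Y \<omega> ^ (2 * q) \<partial>M)" by (simp add: power_mult)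
  ultimately show ?thesis
    unfolding Lp_norm_def using assms
    by (cases "(\<integral>\<omega>. Y \<omega> ^ (2 * q) \<partial>M) = 0") (simp_all add: powr_power)
qed

lemma gauss_norm_even_power:
  assumes "0 < q"
  shows "gauss_norm (real (2 * q)) ^ (2 * q) = fact (2 * q) / (2 ^ q * fact q)"
  unfolding gauss_norm_def Lp_norm_even_power[OF assms]
  by (subst integral_density) (auto simp: integral_std_normal_moment_even)

lemma iid_copies_moment:
  assumes "iid_copies N Y I M X" "finite I" "X \<in> borel_measurable M" "symmetric_rv M X"
    and int: "\<And>k::nat. integrable M (\<lambda>\<omega>. \<bar>X \<omega>\<bar> ^ k)"
    and r: "\<And>k. r k = fact k * (\<integral>\<omega>. X \<omega> ^ (2 * k) \<partial>M) / fact (2 * k)"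
  shows "(\<integral>\<omega>. (\<Sum>i\<in>I. a i * Y i \<omega>) ^ (2 * q) \<partial>N)
    = fact (2 * q) / fact q * occ r (\<lambda>i. (a i)\<^sup>2) I q"
proof -
  interpret N: prob_space N using assms(1) by (simp add: iid_copies_def)
  define \<mu> where "\<mu> k = (\<integral>\<omega>. X \<omega> ^ k \<partial>M)" for k
  have indep: "N.indep_vars (\<lambda>_. borel) Y I" using assms(1) by (simp add: iid_copies_def)
  have dist: "distr N borel (Y i) = distr M borel X" if "i \<in> I" for i
    using assms(1) that by (simp add: iid_copies_def)
  have meas: "Y i \<in> borel_measurable N" if "i \<in> I" for i
    using indep that by (auto simp: N.indep_vars_def)
  have intX: "integrable M (\<lambda>\<omega>. X \<omega> ^ k)" for k
    using assms(3) by (intro Bochner_Integration.integrable_bound[OF int[of k]]) (auto simp: power_abs)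
  have intY: "integrable N (\<lambda>\<omega>. Y i \<omega> ^ k)" if "i \<in> I" for i k
  proof -
    have "integrable (distr M borel X) (\<lambda>t. t ^ k)"
      using intX assms(3) by (simp add: integrable_distr_eq)
    then show ?thesis
      unfolding dist[OF that, symmetric] using meas[OF that] by (simp add: integrable_distr_eq)
  qed
  have muY: "(\<integral>\<omega>. Y i \<omega> ^ k \<partial>N) = \<mu> k" if "i \<in> I" for i k
  proof -
    have "(\<integral>\<omega>. Y i \<omega> ^ k \<partial>N) = (\<integral>t. t ^ k \<partial>distr N borel (Y i))"
      using meas[OF that] by (simp add: integral_distr)
    also have "\<dots> = \<mu> k"
      unfolding dist[OF that] \<mu>_def using assms(3) by (simp add: integral_distr)
    finally show ?thesis .
  qed
  have "(\<integral>\<omega>. (\<Sum>i\<in>I. a i * Y i \<omega>) ^ (2 * q) \<partial>N) = occ \<mu> a I (2 * q)"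
    using N.moments_indep_sum[OF assms(2) indep intY muY] by blast
  also have "\<dots> = fact (2 * q) / fact q * occ r (\<lambda>i. (a i)\<^sup>2) I q"
    using assms symmetric_rv_odd_moment by (intro occ_even_moments) (auto simp: \<mu>_def)
  finally show ?thesis .
qed

section \<open>Occupancy sums with log-concave or log-convex weights\<close>

lemma log_concave_le_geometric:
  assumes "log_concave r" "r 0 = 1"
  shows "r k \<le> r 1 ^ k" and "2 \<le> k \<Longrightarrow> r k \<le> r 2 * r 1 ^ (k - 2)"
proof -
  have pos: "0 < r k" for k using assms by (simp add: log_concave_def)
  have lc: "r k * r (k + 2) \<le> (r (k + 1))\<^sup>2" for k
    using assms(1)[unfolded log_concave_def] by (auto dest: spec[of _ "k + 1"])
  have ratio: "r (Suc k) \<le> r 1 * r k" for k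
  proof (induction k)
    case (Suc k)
    have "r k * r (k + 2) \<le> r (Suc k) * r (Suc k)"
      using lc[of k] by (simp add: power2_eq_square)
    also have "\<dots> \<le> r (Suc k) * (r 1 * r k)"
      using Suc pos[of "Suc k"] by (intro mult_left_mono) auto
    finally have "r k * r (k + 2) \<le> r k * (r 1 * r (Suc k))" by (simp add: mult_ac)
    then show ?case using pos[of k] by simp
  qed (simp add: assms)
  have step: "r (j + k) \<le> r j * r 1 ^ k" for j k
  proof (induction k)
    case (Suc k)
    have "r (j + Suc k) \<le> r 1 * r (j + k)" using ratio[of "j + k"] by simp
    also have "\<dots> \<le> r 1 * (r j * r 1 ^ k)" using Suc pos[of 1] by (intro mult_left_mono) auto
    finally show ?case by (simp add: mult_ac)
  qed simp
  show "r k \<le> r 1 ^ k" using step[of 0 k] assms(2) by simp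
  show "2 \<le> k \<Longrightarrow> r k \<le> r 2 * r 1 ^ (k - 2)" using step[of 2 "k - 2"] by (simp only: le_add_diff_inverse)
qed

lemma log_convex_ge_geometric:
  assumes "log_convex r" "r 0 = 1"
  shows "r 1 ^ k \<le> r k" and "2 \<le> k \<Longrightarrow> r 2 * r 1 ^ (k - 2) \<le> r k"
proof -
  have pos: "0 < r k" for k using assms by (simp add: log_convex_def)
  have lc: "(r (k + 1))\<^sup>2 \<le> r k * r (k + 2)" for k
    using assms(1)[unfolded log_convex_def] by (auto dest: spec[of _ "k + 1"])
  have ratio: "r 1 * r k \<le> r (Suc k)" for k
  proof (induction k)
    case (Suc k)
    have "r (Suc k) * (r 1 * r k) \<le> r (Suc k) * r (Suc k)"
      using Suc pos[of "Suc k"] by (intro mult_left_mono) auto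
    also have "\<dots> \<le> r k * r (k + 2)"
      using lc[of k] by (simp add: power2_eq_square)
    finally have "r k * (r 1 * r (Suc k)) \<le> r k * r (k + 2)" by (simp add: mult_ac)
    then show ?case using pos[of k] by simp
  qed (simp add: assms)
  have step: "r j * r 1 ^ k \<le> r (j + k)" for j k
  proof (induction k)
    case (Suc k)
    have "r 1 * (r j * r 1 ^ k) \<le> r 1 * r (j + k)" using Suc pos[of 1] by (intro mult_left_mono) auto
    also have "\<dots> \<le> r (j + Suc k)" using ratio[of "j + k"] by simp
    finally show ?case by (simp add: mult_ac)
  qed simp
  show "r 1 ^ k \<le> r k" using step[of 0 k] assms(2) by simp
  show "2 \<le> k \<Longrightarrow> r 2 * r 1 ^ (k - 2) \<le> r k" using step[of 2 "k - 2"] by (simp only: le_add_diff_inverse)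
qed

lemma power_split_square:
  fixes c :: "'a::monoid_mult"
  assumes "2 \<le> k"
  shows "c ^ k = c ^ (k - 2) * c\<^sup>2"
  using assms by (metis le_add_diff_inverse2 power_add)

lemma occ_normalised:
  assumes "finite I" "r (1::nat) \<noteq> (0::real)"
  shows "occ r x I m = r 1 ^ m * occ (\<lambda>k. r k / r 1 ^ k) x I m"
  using occ_scale[OF assms(1), of "r 1" "\<lambda>k. r k / r 1 ^ k" x m] assms(2) by simp

lemma normalisation_identity:
  fixes z :: real
  assumes "z = P * s" "\<rho> * s = t"
  shows "z * (D + \<rho> * (1 - D)) = z - P * (s - t) * (1 - D)"
  using assms by algebra

text \<open>
  After division of \<open>r k\<close> by \<open>r 1 ^ k\<close> the weights of 0 and 1 are one, and log-concavity bounds all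
  later ones by that of 2. So a collision multiplies the weight by at most \<open>r 2 / (r 1)\<^sup>2 \<le> 1\<close>.
\<close>
lemma occ_log_concave_le:
  assumes "finite I" "\<And>i. i \<in> I \<Longrightarrow> 0 \<le> x i" "(\<Sum>i\<in>I. x i) = 1"
    and r: "log_concave r" "r 0 = 1" and "2 \<le> q"
  shows "occ r x I q \<le> r 1 ^ q - r 1 ^ (q - 2) * ((r 1)\<^sup>2 - r 2) * (1 - occ inj_weight x I q)"
proof -
  have pos: "0 < r k" for k using r by (simp add: log_concave_def)
  define \<rho> where "\<rho> = r 2 / (r 1)\<^sup>2"
  have "r 2 \<le> (r 1)\<^sup>2" using log_concave_le_geometric(1)[OF r, of 2] .
  have r2: "\<rho> * (r 1)\<^sup>2 = r 2" using pos[of 1] by (simp add: \<rho>_def)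
  have \<rho>: "0 \<le> \<rho>" "\<rho> \<le> 1" using \<open>r 2 \<le> (r 1)\<^sup>2\<close> pos[of 1] pos[of 2] by (auto simp: \<rho>_def)
  have "r k / r 1 ^ k \<le> inj_weight k + \<rho> * (1 - inj_weight k)" for k
  proof (cases "k \<le> 1")
    case True
    then show ?thesis
      using log_concave_le_geometric(1)[OF r, of k] pos[of 1] by (simp add: inj_weight_def)
  next
    case False
    then have "r k \<le> r 2 * r 1 ^ (k - 2)" "r 1 ^ k = r 1 ^ (k - 2) * (r 1)\<^sup>2"
      using log_concave_le_geometric(2)[OF r, of k] by (auto intro: power_split_square)
    then show ?thesis using False pos[of 1] by (simp add: inj_weight_def \<rho>_def divide_simps mult_ac)
  qed
  then have "occ (\<lambda>k. r k / r 1 ^ k) x I q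
    \<le> occ inj_weight x I q + \<rho> * ((\<Sum>i\<in>I. x i) ^ q - occ inj_weight x I q)"
    using assms(1,2) \<rho> pos by (intro occ_le_split) (auto simp: less_imp_le)
  then have "occ r x I q \<le> r 1 ^ q * (occ inj_weight x I q + \<rho> * (1 - occ inj_weight x I q))"
    using occ_normalised[of I r x q] pos[of 1] assms(1,3) by simp
  also have "r 1 ^ q * (occ inj_weight x I q + \<rho> * (1 - occ inj_weight x I q))
    = r 1 ^ q - r 1 ^ (q - 2) * ((r 1)\<^sup>2 - r 2) * (1 - occ inj_weight x I q)"
    using normalisation_identity[OF power_split_square[OF \<open>2 \<le> q\<close>] r2] .
  finally show ?thesis .
qed

lemma occ_log_convex_ge:
  assumes "finite I" "\<And>i. i \<in> I \<Longrightarrow> 0 \<le> x i" "(\<Sum>i\<in>I. x i) = 1"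
    and r: "log_convex r" "r 0 = 1" and "2 \<le> q"
  shows "r 1 ^ q + r 1 ^ (q - 2) * (r 2 - (r 1)\<^sup>2) * (1 - occ inj_weight x I q) \<le> occ r x I q"
proof -
  have pos: "0 < r k" for k using r by (simp add: log_convex_def)
  define \<rho> where "\<rho> = r 2 / (r 1)\<^sup>2"
  have "(r 1)\<^sup>2 \<le> r 2" using log_convex_ge_geometric(1)[OF r, of 2] .
  have r2: "\<rho> * (r 1)\<^sup>2 = r 2" using pos[of 1] by (simp add: \<rho>_def)
  have \<rho>: "1 \<le> \<rho>" using \<open>(r 1)\<^sup>2 \<le> r 2\<close> pos[of 1] pos[of 2] by (auto simp: \<rho>_def)
  have "inj_weight k + \<rho> * (1 - inj_weight k) \<le> r k / r 1 ^ k" for k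
  proof (cases "k \<le> 1")
    case True
    then show ?thesis
      using log_convex_ge_geometric(1)[OF r, of k] pos[of 1] by (simp add: inj_weight_def)
  next
    case False
    then have "r 2 * r 1 ^ (k - 2) \<le> r k" "r 1 ^ k = r 1 ^ (k - 2) * (r 1)\<^sup>2"
      using log_convex_ge_geometric(2)[OF r, of k] by (auto intro: power_split_square)
    then show ?thesis using False pos[of 1] by (simp add: inj_weight_def \<rho>_def divide_simps mult_ac)
  qed
  then have "occ inj_weight x I q + \<rho> * ((\<Sum>i\<in>I. x i) ^ q - occ inj_weight x I q)
      \<le> occ (\<lambda>k. r k / r 1 ^ k) x I q"
    using assms(1,2) \<rho> by (intro occ_ge_split) auto
  then have "r 1 ^ q * (occ inj_weight x I q + \<rho> * (1 - occ inj_weight x I q)) \<le> occ r x I q"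
    using occ_normalised[of I r x q] pos[of 1] assms(1,3) by simp
  moreover have "r 1 ^ q * (occ inj_weight x I q + \<rho> * (1 - occ inj_weight x I q))
    = r 1 ^ q + r 1 ^ (q - 2) * (r 2 - (r 1)\<^sup>2) * (1 - occ inj_weight x I q)"
    using normalisation_identity[OF power_split_square[OF \<open>2 \<le> q\<close>] r2, of "occ inj_weight x I q"]
    by (simp add: algebra_simps)
  ultimately show ?thesis by simp
qed

section \<open>The deficit as a lower bound for the collision probability\<close>

text \<open>
  With \<open>x\<^sub>k = (a k)\<^sup>2\<close>, the quantity \<open>1 - \<Sum> (a k) ^ 4\<close> is twice the second elementary symmetric
  polynomial, so this is Maclaurin's inequality between the means of degrees \<open>2\<close> and \<open>q\<close>.
  For \<open>n < q\<close> a collision is certain.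
\<close>
lemma Delta_le:
  assumes "2 \<le> q" "(\<Sum>k=1..n. (a k)\<^sup>2) = 1"
  shows "Delta q n a \<le> 1 - occ inj_weight (\<lambda>k. (a k)\<^sup>2) {1..n} q"
proof (cases "n < q")
  case True
  then show ?thesis by (simp add: Delta_def occ_inj_eq_0)
next
  case False
  then show ?thesis
    using occ_inj_le_Maclaurin[of "{1..n}" "\<lambda>k. (a k)\<^sup>2" q] assms
    by (simp add: Delta_def flip: power_mult)
qed

text \<open>
  Equality holds in Maclaurin's inequality when all variables agree.
\<close>
lemma Delta_uniform:
  assumes "2 \<le> q" "1 \<le> n"
  shows "Delta q n (\<lambda>_. 1 / sqrt (real n)) = 1 - occ inj_weight (\<lambda>_. 1 / real n) {1..n} q"
proof (cases "n < q")
  case True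
  then show ?thesis by (simp add: Delta_def occ_inj_eq_0)
next
  case False
  have "(1 / sqrt (real n)) ^ 4 = ((1 / sqrt (real n))\<^sup>2)\<^sup>2" by (simp flip: power_mult)
  also have "\<dots> = (1 / real n)\<^sup>2" by (simp add: power_divide)
  finally have e4: "(1 / sqrt (real n)) ^ 4 = (1 / real n)\<^sup>2" .
  have "(1 - (\<Sum>k=1..n. (1 / sqrt (real n)) ^ 4)) / (real n * (real n - 1)) = (1 / real n)\<^sup>2"
    unfolding e4 using assms False by (simp add: divide_simps power2_eq_square)
  moreover have "(1 / real n)\<^sup>2 powr (real q / 2) = (1 / real n) ^ q"
  proof -
    have "(1 / real n)\<^sup>2 powr (real q / 2) = ((1 / real n) powr 2) powr (real q / 2)"
      by simp
    also have "\<dots> = (1 / real n) powr real q" by (simp only: powr_powr) simp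
    also have "\<dots> = (1 / real n) ^ q" using assms by (intro powr_realpow') auto
    finally show ?thesis .
  qed
  ultimately show ?thesis
    using False by (simp only: Delta_def occ_inj_uniform finite_atLeastAtMost) simp
qed

theorem theorem1p4:
  fixes M :: "'a measure" and X :: "'a \<Rightarrow> real" and q p :: nat and r :: "nat \<Rightarrow> real"
  assumes "q \<ge> 2" and "p = 2 * q"
    and "prob_space M" and "X \<in> borel_measurable M"
    and "symmetric_rv M X"
    and "\<not> (AE \<omega> in M. X \<omega> = 0)"
    and "\<And>k::nat. integrable M (\<lambda>\<omega>. \<bar>X \<omega>\<bar> ^ k)"
    and "\<And>k. r k = fact k * (\<integral>\<omega>. X \<omega> ^ (2 * k) \<partial>M) / fact (2 * k)"
  shows
    "let S = (\<lambda>n a Y \<omega>. \<Sum>k=1..n. a k * Y k \<omega>);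
         L = (\<lambda>(N::'b measure) n a Y. Lp_norm N (real p) (S n a Y) ^ p);
         R1 = (\<lambda>(N::'b measure) n a Y.
                 gauss_norm (real p) ^ p * Lp_norm N 2 (S n a Y) ^ p
                 - 2 ^ q * gauss_norm (real p) ^ p * r 1 ^ (q - 2) * ((r 1)\<^sup>2 - r 2) * Delta q n a);
         R2 = (\<lambda>(N::'b measure) n a Y.
                 gauss_norm (real p) ^ p * Lp_norm N 2 (S n a Y) ^ p
                 + 2 ^ q * gauss_norm (real p) ^ p * r 1 ^ (q - 2) * (r 2 - (r 1)\<^sup>2) * Delta q n a)
     in
       (log_concave r \<longrightarrow>
          (r 1)\<^sup>2 - r 2 \<ge> 0 \<and>
          (\<forall>N n a Y. iid_copies N Y {1..n} M X \<longrightarrow> (\<Sum>k=1..n. (a k)\<^sup>2) = 1 \<longrightarrow>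
             L N n a Y \<le> R1 N n a Y) \<and>
          (\<forall>N Y. (\<forall>n\<ge>1. iid_copies (N n) (Y n) {1..n} M X) \<longrightarrow>
             (\<lambda>n. L (N n) n (\<lambda>_. 1 / sqrt (real n)) (Y n)
                  - R1 (N n) n (\<lambda>_. 1 / sqrt (real n)) (Y n)) \<in> O(\<lambda>n. 1 / (real n)\<^sup>2))) \<and>
       (log_convex r \<longrightarrow>
          r 2 - (r 1)\<^sup>2 \<ge> 0 \<and>
          (\<forall>N n a Y. iid_copies N Y {1..n} M X \<longrightarrow> (\<Sum>k=1..n. (a k)\<^sup>2) = 1 \<longrightarrow>
             L N n a Y \<ge> R2 N n a Y) \<and>
          (\<forall>N Y. (\<forall>n\<ge>1. iid_copies (N n) (Y n) {1..n} M X) \<longrightarrow>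
             (\<lambda>n. L (N n) n (\<lambda>_. 1 / sqrt (real n)) (Y n)
                  - R2 (N n) n (\<lambda>_. 1 / sqrt (real n)) (Y n)) \<in> O(\<lambda>n. 1 / (real n)\<^sup>2)))"
proof -
  have r0: "r 0 = 1"
    using assms(3) assms(8)[of 0] by (simp add: prob_space.prob_space)
  define G where "G = gauss_norm (real p) ^ p"
  define T where "T = (\<lambda>n a. occ r (\<lambda>k. (a k)\<^sup>2) {1..n::nat} q)"
  have G: "0 \<le> G" "2 ^ q * G = fact (2 * q) / fact q"
    using gauss_norm_even_power[of q] assms(1,2) by (simp_all add: G_def)
  define S where "S = (\<lambda>n a (Y :: nat \<Rightarrow> 'b \<Rightarrow> real) \<omega>. \<Sum>k=1..n. a k * Y k \<omega>)"
  have L: "Lp_norm N (real p) (S n a Y) ^ p = 2 ^ q * G * T n a"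
    if "iid_copies N Y {1..n} M X" for N :: "'b measure" and n a Y
    using Lp_norm_even_power[of q N "S n a Y"] assms(1,2) G(2)
      iid_copies_moment[OF that _ assms(4,5,7,8), of a q]
    by (simp add: S_def T_def)
  have L2: "G * Lp_norm N 2 (S n a Y) ^ p = 2 ^ q * G * r 1 ^ q"
    if "iid_copies N Y {1..n} M X" "(\<Sum>k=1..n. (a k)\<^sup>2) = 1" for N :: "'b measure" and n a Y
  proof -
    have "Lp_norm N 2 (S n a Y) ^ 2 = 2 * occ r (\<lambda>k. (a k)\<^sup>2) {1..n} 1"
      using Lp_norm_even_power[of 1 N "S n a Y"]
        iid_copies_moment[OF that(1) _ assms(4,5,7,8), of a 1]
      by (simp add: S_def)
    also have "occ r (\<lambda>k. (a k)\<^sup>2) {1..n} 1 = r 1"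
      using occ_degree_1[of "{1..n}" r "\<lambda>k. (a k)\<^sup>2"] r0 that(2) by simp
    finally have "Lp_norm N 2 (S n a Y) ^ p = (2 * r 1) ^ q"
      using assms(2) by (simp add: power_mult)
    then show ?thesis by (simp add: power_mult_distrib)
  qed
  have concave: "T n a \<le> r 1 ^ q - r 1 ^ (q - 2) * ((r 1)\<^sup>2 - r 2) * Delta q n a"
    if "log_concave r" "(\<Sum>k=1..n. (a k)\<^sup>2) = 1" for n a
  proof -
    have "0 \<le> r 1" using that(1) by (simp add: log_concave_def less_imp_le)
    then have "r 1 ^ (q - 2) * ((r 1)\<^sup>2 - r 2) * Delta q n a
      \<le> r 1 ^ (q - 2) * ((r 1)\<^sup>2 - r 2) * (1 - occ inj_weight (\<lambda>k. (a k)\<^sup>2) {1..n} q)"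
      using log_concave_le_geometric(1)[OF that(1) r0, of 2] Delta_le[OF assms(1) that(2)]
      by (intro mult_left_mono) auto
    moreover have "T n a \<le> r 1 ^ q - r 1 ^ (q - 2) * ((r 1)\<^sup>2 - r 2)
        * (1 - occ inj_weight (\<lambda>k. (a k)\<^sup>2) {1..n} q)"
      unfolding T_def using that r0 assms(1) by (intro occ_log_concave_le) auto
    ultimately show ?thesis by linarith
  qed
  have convex: "r 1 ^ q + r 1 ^ (q - 2) * (r 2 - (r 1)\<^sup>2) * Delta q n a \<le> T n a"
    if "log_convex r" "(\<Sum>k=1..n. (a k)\<^sup>2) = 1" for n a
  proof -
    have "0 \<le> r 1" using that(1) by (simp add: log_convex_def less_imp_le)
    then have "r 1 ^ (q - 2) * (r 2 - (r 1)\<^sup>2) * Delta q n a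
      \<le> r 1 ^ (q - 2) * (r 2 - (r 1)\<^sup>2) * (1 - occ inj_weight (\<lambda>k. (a k)\<^sup>2) {1..n} q)"
      using log_convex_ge_geometric(1)[OF that(1) r0, of 2] Delta_le[OF assms(1) that(2)]
      by (intro mult_left_mono) auto
    moreover have "r 1 ^ q + r 1 ^ (q - 2) * (r 2 - (r 1)\<^sup>2)
        * (1 - occ inj_weight (\<lambda>k. (a k)\<^sup>2) {1..n} q) \<le> T n a"
      unfolding T_def using that r0 assms(1) by (intro occ_log_convex_ge) auto
    ultimately show ?thesis by linarith
  qed
  have sharp: "(\<lambda>n. Lp_norm (N n) (real p) (S n (\<lambda>_. 1 / sqrt (real n)) (Y n)) ^ p
      - (G * Lp_norm (N n) 2 (S n (\<lambda>_. 1 / sqrt (real n)) (Y n)) ^ p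
         - 2 ^ q * G * r 1 ^ (q - 2) * ((r 1)\<^sup>2 - r 2) * Delta q n (\<lambda>_. 1 / sqrt (real n))))
      \<in> O(\<lambda>n. 1 / (real n)\<^sup>2)"
    if iid: "\<forall>n\<ge>1. iid_copies (N n) (Y n) {1..n} M X" for N :: "nat \<Rightarrow> 'b measure" and Y
  proof -
    obtain C where C: "\<And>I :: nat set. finite I \<Longrightarrow> I \<noteq> {} \<Longrightarrow>
      (let n = real (card I); D = occ inj_weight (\<lambda>_. 1 / n) I q
       in \<bar>occ r (\<lambda>_. 1 / n) I q - r 1 ^ q * D - r 1 ^ (q - 2) * r 2 * (1 - D)\<bar> \<le> C / n\<^sup>2)"
      using occ_uniform_defect[where r = r and q = q, OF r0 assms(1)] by blast
    show ?thesis
    proof (rule bigoI[of _ "2 ^ q * G * C"], rule eventually_at_top_linorderI[of 1])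
      fix n :: nat assume n: "1 \<le> n"
      let ?a = "\<lambda>_::nat. 1 / sqrt (real n)"
      define D where "D = occ inj_weight (\<lambda>_. 1 / real n) {1..n} q"
      have sq: "(1 / sqrt (real n))\<^sup>2 = 1 / real n" by (simp add: power_divide)
      have a: "(\<Sum>k=1..n. (?a k)\<^sup>2) = 1" unfolding sq using n by simp
      have "Lp_norm (N n) (real p) (S n ?a (Y n)) ^ p
        - (G * Lp_norm (N n) 2 (S n ?a (Y n)) ^ p
           - 2 ^ q * G * r 1 ^ (q - 2) * ((r 1)\<^sup>2 - r 2) * Delta q n ?a)
        = 2 ^ q * G * T n ?a - (2 ^ q * G * r 1 ^ q
           - 2 ^ q * G * r 1 ^ (q - 2) * ((r 1)\<^sup>2 - r 2) * (1 - D))"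
        using L[of "N n" "Y n" n ?a] L2[of "N n" "Y n" n ?a] iid n a Delta_uniform[OF assms(1) n]
        by (simp add: D_def)
      also have "\<dots> = 2 ^ q * G * (T n ?a - r 1 ^ q * D - r 1 ^ (q - 2) * r 2 * (1 - D))"
      proof -
        have "g * t - (g * z - g * P * (s - u) * (1 - D)) = g * (t - z * D - P * u * (1 - D))"
          if "z = P * s" for g t z P s u D :: real
          using that by algebra
        then show ?thesis using power_split_square[OF assms(1), of "r 1"] by blast
      qed
      also have "\<bar>\<dots>\<bar> = 2 ^ q * G * \<bar>T n ?a - r 1 ^ q * D - r 1 ^ (q - 2) * r 2 * (1 - D)\<bar>"
        using G(1) by (simp add: abs_mult)
      also have "\<dots> \<le> 2 ^ q * G * (C / (real n)\<^sup>2)"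
        using C[of "{1..n}"] n G(1) unfolding T_def sq D_def
        by (intro mult_left_mono) (auto simp: Let_def)
      finally show "norm (Lp_norm (N n) (real p) (S n ?a (Y n)) ^ p
        - (G * Lp_norm (N n) 2 (S n ?a (Y n)) ^ p
           - 2 ^ q * G * r 1 ^ (q - 2) * ((r 1)\<^sup>2 - r 2) * Delta q n ?a))
        \<le> 2 ^ q * G * C * norm (1 / (real n)\<^sup>2)"
        by simp
    qed
  qed
  \<comment> \<open>The right-hand sides for the two cases are the same expression, hence one sharpness estimate.\<close>
  have R2: "G * l + 2 ^ q * G * r 1 ^ (q - 2) * (r 2 - (r 1)\<^sup>2) * d
    = G * l - 2 ^ q * G * r 1 ^ (q - 2) * ((r 1)\<^sup>2 - r 2) * d" for l d
    by (simp add: algebra_simps)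
  have upper: "Lp_norm N (real p) (S n a Y) ^ p \<le> G * Lp_norm N 2 (S n a Y) ^ p
      - 2 ^ q * G * r 1 ^ (q - 2) * ((r 1)\<^sup>2 - r 2) * Delta q n a"
    if "log_concave r" "iid_copies N Y {1..n} M X" "(\<Sum>k=1..n. (a k)\<^sup>2) = 1"
    for N :: "'b measure" and n a Y
  proof -
    have "2 ^ q * G * T n a
      \<le> 2 ^ q * G * (r 1 ^ q - r 1 ^ (q - 2) * ((r 1)\<^sup>2 - r 2) * Delta q n a)"
      using concave[OF that(1,3)] G(1) by (intro mult_left_mono) auto
    then show ?thesis
      unfolding L[OF that(2)] L2[OF that(2,3)]
      by (simp only: right_diff_distrib[of "2 ^ q * G"])
  qed
  have lower: "G * Lp_norm N 2 (S n a Y) ^ p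
      + 2 ^ q * G * r 1 ^ (q - 2) * (r 2 - (r 1)\<^sup>2) * Delta q n a \<le> Lp_norm N (real p) (S n a Y) ^ p"
    if "log_convex r" "iid_copies N Y {1..n} M X" "(\<Sum>k=1..n. (a k)\<^sup>2) = 1"
    for N :: "'b measure" and n a Y
  proof -
    have "2 ^ q * G * (r 1 ^ q + r 1 ^ (q - 2) * (r 2 - (r 1)\<^sup>2) * Delta q n a)
      \<le> 2 ^ q * G * T n a"
      using convex[OF that(1,3)] G(1) by (intro mult_left_mono) auto
    then show ?thesis
      unfolding L[OF that(2)] L2[OF that(2,3)] by (simp add: distrib_left mult.assoc)
  qed
  have "0 \<le> (r 1)\<^sup>2 - r 2" if "log_concave r"
    using log_concave_le_geometric(1)[OF that r0, of 2] by simp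
  moreover have "0 \<le> r 2 - (r 1)\<^sup>2" if "log_convex r"
    using log_convex_ge_geometric(1)[OF that r0, of 2] by simp
  ultimately show ?thesis
    unfolding Let_def G_def[symmetric]
    using upper lower sharp sharp[folded R2]
    unfolding S_def by blast
qed

end
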